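(* Let $n\ge 2$. Every element $x\in\mathfrak{F}^{2,n}$ of a given rank is related, by an element of the automorphism group $\mathrm{Aut}(\mathfrak{F}^{2,n})$ (identified with $\mathrm{SL}(2,\mathbb{R})\times\mathrm{SO}(2,n)$), to one of the following canonical forms: 1. Rank 1: (a) $x_1=\begin{pmatrix}1&0\\0&0\end{pmatrix}$. 2. Rank 2: (a) $x_{2a}=\begin{pmatrix}1&(1;0,0)\\0&0\end{pmatrix}$; (b) $x_{2b}=\begin{pmatrix}1&(-1;0,0)\\0&0\end{pmatrix}$; (c) $x_{2c}=\begin{pmatrix}1&(0;\tfrac12,\tfrac12)\\0&0\end{pmatrix}$. 3. Rank 3: (a) $x_{3a}=\begin{pmatrix}1&(0;1,0)\\0&0\end{pmatrix}$; (b) $x_{3b}=\begin{pmatrix}1&(0;0,1)\\0&0\end{pmatrix}$. 4. Rank 4: (a) $x_{4a}=k\begin{pmatrix}1&(-1;1,0)\\0&0\end{pmatrix}$; (b) $x_{4b}=k\begin{pmatrix}1&(1;0,1)\\0&0\end{pmatrix}$; (c) $x_{4c}=k\begin{pmatrix}1&(-1;0,1)\\0&0\end{pmatrix}$, where $k>0$.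
   Context: Jordan algebra. $\mathfrak{J}_{1,n-1}=\mathbb{R}\oplus\Gamma_{1,n-1}$ has underlying vector space $\mathbb{R}\oplus\mathbb{R}^{1,n-1}$, with elements $A=(a;a_\mu)=(a;a_0,a_i)$, $i=1,\dots,n-1$; indices are raised with $\eta=\mathrm{diag}(1,-1,\dots,-1)$. The notation $(a;a_0,a_1)$ means $a_i=0$ for $i>1$. Cubic norm: $N(A)=a\,a_\mu a^\mu=a(a_0^2-\sum_i a_i^2)$. Trace bilinear form: $\mathrm{Tr}(A,B)=ab+2(a_0b_0+\sum_i a_ib_i)$. Quadratic adjoint: $A^\sharp=(a_\mu a^\mu;\,a\,a^\mu)$. Freudenthal triple system. $\mathfrak{F}^{2,n}=\mathfrak{F}(\mathfrak{J}_{1,n-1})=\mathbb{R}\oplus\mathbb{R}\oplus\mathfrak{J}_{1,n-1}\oplus\mathfrak{J}_{1,n-1}$, with elements written $x=\begin{pmatrix}\alpha & A \\ B & \beta\end{pmatrix}$, $\alpha,\beta\in\mathbb{R}$, $A,B\in\mathfrak{J}_{1,n-1}$. For $y=\begin{pmatrix}\gamma & C \\ D & \delta\end{pmatrix}$, the antisymmetric bilinear form is $$\{x,y\}=\alpha\delta-\beta\gamma+\mathrm{Tr}(A,D)-\mathrm{Tr}(B,C),$$ and the quartic form is $$\Delta(x)=-(\alpha\beta-\mathrm{Tr}(A,B))^2-4[\alpha N(A)+\beta N(B)-\mathrm{Tr}(A^\sharp,B^\sharp)].$$ Let $\Delta(x,y,w,z)$ be its full symmetric linearization, normalized by $\Delta(x,x,x,x)=\Delta(x)$.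 The triple product $T$ is defined by $\{T(x,y,w),z\}=2\Delta(x,y,w,z)$ for all $z$, and $T(x):=T(x,x,x)$. Put $\Upsilon(x,x,y)=3T(x,x,y)+\{x,y\}x$. Rank. A non-zero $x$ has rank 1 iff $\Upsilon(x,x,y)=0$ for all $y$; rank 2 iff $T(x)=0$ and $\Upsilon(x,x,y)\neq0$ for some $y$; rank 3 iff $\Delta(x)=0$ and $T(x)\neq0$; rank 4 iff $\Delta(x)\ne0$. Group. $\mathrm{Aut}(\mathfrak{F})$ is the group of invertible $\mathbb{R}$-linear maps $\sigma:\mathfrak{F}\to\mathfrak{F}$ with $\{\sigma x,\sigma y\}=\{x,y\}$ and $\Delta(\sigma x)=\Delta(x)$ for all $x,y$. Elements $x,x'$ are related if $x'=\sigma x$ for some $\sigma\in\mathrm{Aut}(\mathfrak{F})$. The real number $k>0$ depends on $x$. *)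

theory Defs
  imports "HOL-Analysis.Analysis"
begin

text \<open>
  The finite type \<open>'m\<close> indexes the spatial directions \<open>i = 1, \<dots>, n - 1\<close> of Minkowski space
  \<open>\<real>\<^bsup>1,n-1\<^esup>\<close>, so \<open>n = CARD('m) + 1\<close>. As types are nonempty, an arbitrary \<open>'m\<close>
  is the same as an arbitrary \<open>n \<ge> 2\<close>.
  A triple \<open>(a, a0, v)\<close> is the Jordan algebra element \<open>(a; a\<^sub>0, a\<^sub>i)\<close> with \<open>v $ i = a\<^sub>i\<close>.
\<close>

type_synonym 'm jordan = "real \<times> real \<times> (real, 'm) vec"

text \<open>The inner product \<open>v \<bullet> w\<close> on \<^typ>\<open>real ^ 'm\<close> is \<open>\<Sum>\<^sub>i v\<^sub>i w\<^sub>i\<close>. Raising an index with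
  \<open>\<eta> = diag(1, -1, \<dots>, -1)\<close> flips the sign of the spatial part.\<close>

fun mink :: "real \<times> (real ^ 'm) \<Rightarrow> real \<times> (real ^ 'm) \<Rightarrow> real" where
  "mink (a0, v) (b0, w) = a0 * b0 - v \<bullet> w"

fun cubic_norm :: "'m::finite jordan \<Rightarrow> real" where
  "cubic_norm (a, a0, v) = a * mink (a0, v) (a0, v)"

fun trace_form :: "'m::finite jordan \<Rightarrow> 'm jordan \<Rightarrow> real" where
  "trace_form (a, a0, v) (b, b0, w) = a * b + 2 * (a0 * b0 + v \<bullet> w)"

fun sharp :: "'m::finite jordan \<Rightarrow> 'm jordan" where
  "sharp (a, a0, v) = (mink (a0, v) (a0, v), a * a0, - (a *\<^sub>R v))"

text \<open>\<open>(a; a\<^sub>0, a\<^sub>1)\<close>, where \<open>i1\<close> is the spatial index called 1.\<close>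

definition jelem :: "'m::finite \<Rightarrow> real \<Rightarrow> real \<Rightarrow> real \<Rightarrow> 'm jordan" where
  "jelem i1 a a0 a1 = (a, a0, axis i1 a1)"

text \<open>
  The tuple \<open>(\<alpha>, A, B, \<beta>)\<close> is the two-by-two array with rows \<open>\<alpha>, A\<close> and \<open>B, \<beta>\<close>.
\<close>

type_synonym 'm fts = "real \<times> 'm jordan \<times> 'm jordan \<times> real"

fun fts_form :: "'m::finite fts \<Rightarrow> 'm fts \<Rightarrow> real" where
  "fts_form (\<alpha>, A, B, \<beta>) (\<gamma>, C, D, \<delta>) =
     \<alpha> * \<delta> - \<beta> * \<gamma> + trace_form A D - trace_form B C"

fun quartic :: "'m::finite fts \<Rightarrow> real" where
  "quartic (\<alpha>, A, B, \<beta>) =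
     - (\<alpha> * \<beta> - trace_form A B)\<^sup>2
     - 4 * (\<alpha> * cubic_norm A + \<beta> * cubic_norm B - trace_form (sharp A) (sharp B))"

text \<open>
  The full linearization, given by the polarization identity. The lemmas below show that it is
  the symmetric four-linear form that restricts to the quartic form on the diagonal.
\<close>

definition polar4 :: "('a::real_vector \<Rightarrow> real) \<Rightarrow> 'a \<Rightarrow> 'a \<Rightarrow> 'a \<Rightarrow> 'a \<Rightarrow> real" where
  "polar4 f x y w z =
     (f (x + y + w + z)
      - f (x + y + w) - f (x + y + z) - f (x + w + z) - f (y + w + z)
      + f (x + y) + f (x + w) + f (x + z) + f (y + w) + f (y + z) + f (w + z)
      - f x - f y - f w - f z) / 24"

definition quartic_lin :: "'m::finite fts \<Rightarrow> 'm fts \<Rightarrow> 'm fts \<Rightarrow> 'm fts \<Rightarrow> real" where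
  "quartic_lin = polar4 quartic"

text \<open>The unique existence of the triple product is shown in \<open>triple_prod_iff\<close> below.\<close>

definition triple_prod :: "'m::finite fts \<Rightarrow> 'm fts \<Rightarrow> 'm fts \<Rightarrow> 'm fts" where
  "triple_prod x y w = (THE t. \<forall>z. fts_form t z = 2 * quartic_lin x y w z)"

definition Upsilon :: "'m::finite fts \<Rightarrow> 'm fts \<Rightarrow> 'm fts" where
  "Upsilon x y = 3 *\<^sub>R triple_prod x x y + fts_form x y *\<^sub>R x"

definition rank1 :: "'m::finite fts \<Rightarrow> bool" where
  "rank1 x \<longleftrightarrow> x \<noteq> 0 \<and> (\<forall>y. Upsilon x y = 0)"

definition rank2 :: "'m::finite fts \<Rightarrow> bool" where
  "rank2 x \<longleftrightarrow> x \<noteq> 0 \<and> triple_prod x x x = 0 \<and> (\<exists>y. Upsilon x y \<noteq> 0)"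

definition rank3 :: "'m::finite fts \<Rightarrow> bool" where
  "rank3 x \<longleftrightarrow> x \<noteq> 0 \<and> quartic x = 0 \<and> triple_prod x x x \<noteq> 0"

definition rank4 :: "'m::finite fts \<Rightarrow> bool" where
  "rank4 x \<longleftrightarrow> x \<noteq> 0 \<and> quartic x \<noteq> 0"

definition Aut :: "('m::finite fts \<Rightarrow> 'm fts) set" where
  "Aut = {\<sigma>. linear \<sigma> \<and> bij \<sigma> \<and>
              (\<forall>x y. fts_form (\<sigma> x) (\<sigma> y) = fts_form x y) \<and>
              (\<forall>x. quartic (\<sigma> x) = quartic x)}"

definition related :: "'m::finite fts \<Rightarrow> 'm fts \<Rightarrow> bool" where
  "related x x' \<longleftrightarrow> (\<exists>\<sigma>\<in>Aut. x' = \<sigma> x)"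


subsection \<open>The linearization is symmetric, four-linear and normalized\<close>

lemma polar4_prod:
  fixes P Q :: "'a::real_vector \<Rightarrow> 'a \<Rightarrow> real"
  assumes "bilinear P" "bilinear Q" "\<And>x y. P x y = P y x" "\<And>x y. Q x y = Q y x"
  shows "polar4 (\<lambda>x. P x x * Q x x) x y w z =
    (P x y * Q w z + P w z * Q x y + P x w * Q y z + P y z * Q x w
     + P x z * Q y w + P y w * Q x z) / 6"
proof -
  have add2: "R (u + v) (u + v) = R u u + R v v + 2 * R u v"
    if "bilinear R" "\<And>x y. R x y = R y x" for R :: "'a \<Rightarrow> 'a \<Rightarrow> real" and u v
    using that(2)[of v u] by (simp add: bilinear_ladd[OF that(1)] bilinear_radd[OF that(1)])
  have alg: "l / 24 = r / 6 \<longleftrightarrow> l = 4 * r" for l r :: real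
    by auto
  show ?thesis
    unfolding polar4_def alg add2[OF assms(1,3)] add2[OF assms(2,4)]
    unfolding bilinear_ladd[OF assms(1)] bilinear_ladd[OF assms(2)]
    by algebra
qed

lemma polar4_lincomb:
  "polar4 (\<lambda>x. f x + g x) x y w z = polar4 f x y w z + polar4 g x y w z"
  "polar4 (\<lambda>x. f x - g x) x y w z = polar4 f x y w z - polar4 g x y w z"
  "polar4 (\<lambda>x. c * f x) x y w z = c * polar4 f x y w z"
  by (simp_all add: polar4_def field_simps)

text \<open>The quartic form is a combination of products of the following quadratic forms.\<close>

fun qA :: "'m::finite fts \<Rightarrow> 'm fts \<Rightarrow> real" where
  "qA (\<alpha>, (a, A), (b, B), \<beta>) (\<gamma>, (c, C), (d, D), \<delta>) = mink A C"

fun qB :: "'m::finite fts \<Rightarrow> 'm fts \<Rightarrow> real" where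
  "qB (\<alpha>, (a, A), (b, B), \<beta>) (\<gamma>, (c, C), (d, D), \<delta>) = mink B D"

fun qaA :: "'m::finite fts \<Rightarrow> 'm fts \<Rightarrow> real" where
  "qaA (\<alpha>, (a, A), (b, B), \<beta>) (\<gamma>, (c, C), (d, D), \<delta>) = (\<alpha> * c + a * \<gamma>) / 2"

fun qbB :: "'m::finite fts \<Rightarrow> 'm fts \<Rightarrow> real" where
  "qbB (\<alpha>, (a, A), (b, B), \<beta>) (\<gamma>, (c, C), (d, D), \<delta>) = (\<beta> * d + b * \<delta>) / 2"

fun qAB :: "'m::finite fts \<Rightarrow> 'm fts \<Rightarrow> real" where
  "qAB (\<alpha>, A, B, \<beta>) (\<gamma>, C, D, \<delta>) =
     (\<alpha> * \<delta> + \<beta> * \<gamma> - trace_form A D - trace_form B C) / 2"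

fun qab :: "'m::finite fts \<Rightarrow> 'm fts \<Rightarrow> real" where
  "qab (\<alpha>, (a, A), (b, B), \<beta>) (\<gamma>, (c, C), (d, D), \<delta>) = (a * d + b * c) / 2"

fun qE :: "'m::finite fts \<Rightarrow> 'm fts \<Rightarrow> real" where
  "qE (\<alpha>, (a, A), (b, B), \<beta>) (\<gamma>, (c, C), (d, D), \<delta>) = (A \<bullet> D + B \<bullet> C) / 2"

lemma bilinear_q:
  "bilinear qA" "bilinear qB" "bilinear qaA" "bilinear qbB" "bilinear qAB" "bilinear qab" "bilinear qE"
  by (auto simp: bilinear_def inner_simps field_simps intro!: linearI)

lemma trace_form_commute: "trace_form A B = trace_form B A"
  by (induction A B rule: trace_form.induct) (simp add: inner_commute)

lemma mink_commute: "mink p q = mink q p"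
  by (induction p q rule: mink.induct) (simp add: inner_commute)

lemma sym_q:
  "qA x y = qA y x" "qB x y = qB y x" "qaA x y = qaA y x" "qbB x y = qbB y x"
  "qAB x y = qAB y x" "qab x y = qab y x" "qE x y = qE y x"
proof -
  show "qA x y = qA y x"
    by (induction x y rule: qA.induct) (simp only: qA.simps mink_commute)
  show "qB x y = qB y x"
    by (induction x y rule: qB.induct) (simp only: qB.simps mink_commute)
  show "qaA x y = qaA y x"
    by (induction x y rule: qaA.induct) simp
  show "qbB x y = qbB y x"
    by (induction x y rule: qbB.induct) simp
  show "qAB x y = qAB y x"
    by (induction x y rule: qAB.induct) (simp add: trace_form_commute)
  show "qab x y = qab y x"
    by (induction x y rule: qab.induct) simp
  show "qE x y = qE y x"
    by (induction x y rule: qE.induct) (simp add: inner_commute)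
qed

lemma bilinear_fts_form: "bilinear fts_form"
  by (auto simp: bilinear_def inner_simps field_simps intro!: linearI)

lemma quartic_q:
  "quartic x = 4 * (qA x x * qB x x) + 8 * (qab x x * qE x x)
     - (qAB x x * qAB x x + 4 * (qaA x x * qA x x) + 4 * (qbB x x * qB x x))"
  by (cases x) (auto simp: inner_commute power2_eq_square field_simps)

lemma quartic_lin_q:
  "quartic_lin x y w z =
     4 * polar4 (\<lambda>x. qA x x * qB x x) x y w z + 8 * polar4 (\<lambda>x. qab x x * qE x x) x y w z
     - (polar4 (\<lambda>x. qAB x x * qAB x x) x y w z + 4 * polar4 (\<lambda>x. qaA x x * qA x x) x y w z
        + 4 * polar4 (\<lambda>x. qbB x x * qB x x) x y w z)"
proof -
  have "quartic_lin x y w z = polar4 (\<lambda>x. 4 * (qA x x * qB x x) + 8 * (qab x x * qE x x)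
     - (qAB x x * qAB x x + 4 * (qaA x x * qA x x) + 4 * (qbB x x * qB x x))) x y w z"
    unfolding quartic_lin_def by (rule arg_cong[where f = "\<lambda>f. polar4 f x y w z"])
      (simp add: fun_eq_iff quartic_q)
  then show ?thesis by (simp only: polar4_lincomb)
qed

lemma quartic_lin_diag: "quartic_lin x x x x = quartic x"
proof -
  have "polar4 (\<lambda>x. qA x x * qB x x) x x x x = qA x x * qB x x"
    "polar4 (\<lambda>x. qab x x * qE x x) x x x x = qab x x * qE x x"
    "polar4 (\<lambda>x. qAB x x * qAB x x) x x x x = qAB x x * qAB x x"
    "polar4 (\<lambda>x. qaA x x * qA x x) x x x x = qaA x x * qA x x"
    "polar4 (\<lambda>x. qbB x x * qB x x) x x x x = qbB x x * qB x x"
    by (subst polar4_prod; (rule bilinear_q sym_q)?; simp)+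
  then show ?thesis unfolding quartic_lin_q quartic_q by simp
qed

lemma quartic_lin_sym:
  "quartic_lin y x w z = quartic_lin x y w z"
  "quartic_lin x w y z = quartic_lin x y w z"
  "quartic_lin x y z w = quartic_lin x y w z"
  by (simp_all add: quartic_lin_def polar4_def ac_simps)

lemma linear_polar4_prod:
  fixes P Q :: "'a::real_vector \<Rightarrow> 'a \<Rightarrow> real"
  assumes "bilinear P" "bilinear Q" "\<And>x y. P x y = P y x" "\<And>x y. Q x y = Q y x"
  shows "linear (\<lambda>z. polar4 (\<lambda>x. P x x * Q x x) x y w z)"
  by (rule linearI)
    (simp_all add: polar4_prod[OF assms] bilinear_radd[OF assms(1)] bilinear_radd[OF assms(2)]
      bilinear_rmul[OF assms(1)] bilinear_rmul[OF assms(2)] field_simps)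

lemma linear_quartic_lin: "linear (quartic_lin x y w)"
proof -
  note lin = linear_polar4_prod bilinear_q sym_q
  have "linear (\<lambda>z. polar4 (\<lambda>x. qA x x * qB x x) x y w z)"
    "linear (\<lambda>z. polar4 (\<lambda>x. qab x x * qE x x) x y w z)"
    "linear (\<lambda>z. polar4 (\<lambda>x. qAB x x * qAB x x) x y w z)"
    "linear (\<lambda>z. polar4 (\<lambda>x. qaA x x * qA x x) x y w z)"
    "linear (\<lambda>z. polar4 (\<lambda>x. qbB x x * qB x x) x y w z)"
    by (intro lin)+
  from this[THEN linear_add] this[THEN linear_scale] show ?thesis
    by (intro linearI) (simp_all add: quartic_lin_q algebra_simps)
qed


subsection \<open>The triple product is well defined\<close>

lemma trace_form_self: "trace_form A A \<ge> 0" "trace_form A A = 0 \<Longrightarrow> A = 0"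
proof (atomize (full), cases A)
  case (fields a a0 v)
  have "a * a \<ge> 0" "a0 * a0 \<ge> 0" "v \<bullet> v \<ge> 0"
    by simp_all
  then show "0 \<le> trace_form A A \<and> (trace_form A A = 0 \<longrightarrow> A = 0)"
    unfolding fields by (auto simp: zero_prod_def add_nonneg_eq_0_iff)
qed

lemma fts_form_nondegenerate:
  assumes "\<And>z. fts_form t z = fts_form t' z"
  shows "t = t'"
proof -
  obtain \<alpha> A B \<beta> where u: "t - t' = (\<alpha>, A, B, \<beta>)" by (cases "t - t'")
  have neg: "trace_form B (- B) = - trace_form B B"
    by (cases B) simp
  have "fts_form (t - t') (- \<beta>, - B, A, \<alpha>) = 0"
    using assms by (simp add: bilinear_lsub[OF bilinear_fts_form])
  then have "\<alpha> * \<alpha> + \<beta> * \<beta> + trace_form A A + trace_form B B = 0"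
    unfolding u by (simp add: neg)
  moreover have "\<alpha> * \<alpha> \<ge> 0" "\<beta> * \<beta> \<ge> 0" by simp_all
  ultimately have "\<alpha> * \<alpha> = 0" "\<beta> * \<beta> = 0" "trace_form A A = 0" "trace_form B B = 0"
    using trace_form_self(1)[of A] trace_form_self(1)[of B] by linarith+
  then have "t - t' = 0"
    unfolding u using trace_form_self(2)[of A] trace_form_self(2)[of B] by (simp add: zero_prod_def)
  then show ?thesis by simp
qed

lemma fts_form_represents:
  fixes f :: "'m::finite fts \<Rightarrow> real"
  assumes "linear f"
  shows "\<exists>t. \<forall>z. fts_form t z = f z"
proof -
  obtain p q r s c d e g where v: "adjoint f 1 = (p, (q, r, s), (c, d, e), g)"
    by (metis prod.exhaust)
  have "fts_form (g, (c, d / 2, e /\<^sub>R 2), (- q, - r / 2, - (s /\<^sub>R 2)), - p) z = f z" for z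
  proof -
    have "f z = z \<bullet> (p, (q, r, s), (c, d, e), g)"
      using adjoint_works[OF assms, of z 1] by (simp add: v)
    moreover obtain a a0 a1 b b0 b1 \<alpha> \<beta> where "z = (\<alpha>, (a, a0, a1), (b, b0, b1), \<beta>)"
      by (metis prod.exhaust)
    ultimately show ?thesis by (simp add: inner_commute algebra_simps)
  qed
  then show ?thesis by blast
qed

lemma triple_prod_iff:
  "t = triple_prod x y w \<longleftrightarrow> (\<forall>z. fts_form t z = 2 * quartic_lin x y w z)"
proof -
  let ?P = "\<lambda>t. \<forall>z. fts_form t z = 2 * quartic_lin x y w z"
  have "linear (\<lambda>z. 2 * quartic_lin x y w z)"
    using linear_compose_scale_right[OF linear_quartic_lin, of 2 x y w] by simp
  then have "\<exists>t. ?P t" by (rule fts_form_represents)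
  moreover have "t = t'" if "?P t" "?P t'" for t t'
    by (rule fts_form_nondegenerate) (simp only: that)
  ultimately have ex1: "\<exists>!t. ?P t" by blast
  then show ?thesis
    unfolding triple_prod_def using theI'[OF ex1] the1_equality[OF ex1] by blast
qed

end

theory Submission
  imports Defs
begin

text \<open>
  The triple system is a space of pairs of vectors. Regroup the components of
  \<open>x = (\<alpha>, (a; A), (b; B), \<beta>)\<close> into \<open>p = (A; \<beta>, b)\<close> and \<open>q = (B'; a, \<alpha>)\<close>, where \<open>B'\<close> is \<open>B\<close>
  with its spatial part negated, and give these vectors the scalar product
  \<open>\<langle>(A; s, t), (A'; s', t')\<rangle> = A\<^sub>\<mu> A'\<^sup>\<mu> - (s t' + t s') / 2\<close> of signature \<open>(2, n)\<close>. Then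
  \<open>{x, x'} = 2 (\<langle>p, q'\<rangle> - \<langle>q, p'\<rangle>)\<close> and \<open>\<Delta>(x) = 4 (\<langle>p, p\<rangle> \<langle>q, q\<rangle> - \<langle>p, q\<rangle>\<^sup>2)\<close>, four times the Gram
  determinant (\<open>fts_form_vecs\<close>, \<open>quartic_vecs\<close>). Both are visibly invariant under an isometry
  applied to \<open>p\<close> and \<open>q\<close> alike, and under replacing \<open>(p, q)\<close> by combinations with a
  coefficient matrix of determinant 1 (\<open>related_isometry\<close>, \<open>related_unimodular\<close>).

  So the task is to classify pairs of vectors. If \<open>p\<close> and \<open>q\<close> are dependent, a unimodular change
  makes \<open>p = 0\<close>. Otherwise one makes them orthogonal by Gram-Schmidt, and then
  rescales them inversely to each other to normalize \<open>\<langle>p, p\<rangle>\<close> and \<open>\<langle>q, q\<rangle>\<close>. What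
  remains is Witt's theorem for one vector and for an orthogonal pair, proved with
  reflections (\<open>isometry_transitive_fixing\<close>): the squares \<open>\<langle>p, p\<rangle>\<close> and \<open>\<langle>q, q\<rangle>\<close> then determine the
  orbit, and up to exchanging \<open>p\<close> and \<open>q\<close> every combination of signs belongs to a canonical form.

  The rank is an invariant of the orbit (\<open>rank_related\<close>), hence need only be compared with the
  squares on the reduced pairs: for \<open>(0, q)\<close> it is 1 or 2 according to whether \<open>q\<close>
  is null (\<open>rank_single\<close>), and for an independent orthogonal pair it is 2, 3 or 4 according to
  whether none, one or both of the two vectors are non-null (\<open>rank_orthogonal_pair\<close>).
\<close>

section \<open>Isometries of a symmetric bilinear form\<close>

locale sym_bilinear_form =
  fixes B :: "'v::real_vector \<Rightarrow> 'v \<Rightarrow> real"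
  assumes bilinear: "bilinear B" and sym: "B x y = B y x"
begin

lemmas B_simps =
  bilinear_ladd[OF bilinear] bilinear_radd[OF bilinear]
  bilinear_lsub[OF bilinear] bilinear_rsub[OF bilinear]
  bilinear_lneg[OF bilinear] bilinear_rneg[OF bilinear]
  bilinear_lmul[OF bilinear] bilinear_rmul[OF bilinear]
  bilinear_lzero[OF bilinear] bilinear_rzero[OF bilinear]

definition isometry :: "('v \<Rightarrow> 'v) \<Rightarrow> bool" where
  "isometry g \<longleftrightarrow> linear g \<and> (\<forall>x y. B (g x) (g y) = B x y)"

lemma isometry_compose: "isometry g \<Longrightarrow> isometry h \<Longrightarrow> isometry (g \<circ> h)"
  by (auto simp: isometry_def intro: linear_compose)

definition reflection :: "'v \<Rightarrow> 'v \<Rightarrow> 'v" where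
  "reflection v x = x - (2 * B v x / B v v) *\<^sub>R v"

lemma isometry_reflection:
  assumes "B v v \<noteq> 0"
  shows "isometry (reflection v)"
  unfolding isometry_def
proof (intro conjI allI)
  show "linear (reflection v)"
    by (rule linearI)
      (simp_all add: reflection_def B_simps algebra_simps add_divide_distrib)
  show "B (reflection v x) (reflection v y) = B x y" for x y
    using assms by (simp add: reflection_def B_simps sym[of x v] field_simps)
qed

lemma reflection_fixes: "B v k = 0 \<Longrightarrow> reflection v k = k"
  by (simp add: reflection_def)

lemma reflection_diff:
  assumes "B u u = B v v" "B (u - v) (u - v) \<noteq> 0"
  shows "reflection (u - v) u = v"
proof -
  have "2 * B (u - v) u = B (u - v) (u - v)"
    using assms(1) by (simp add: B_simps sym[of v u])
  then show ?thesis
    using assms(2) by (simp add: reflection_def)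
qed

text \<open>
  Witt's theorem for a single vector, relative to a set \<open>K\<close> of vectors to be fixed. The reflection
  in \<open>u - u'\<close> exchanges \<open>u\<close> and \<open>u'\<close>, and it fixes \<open>K\<close> because \<open>u\<close> and \<open>u'\<close> are orthogonal to \<open>K\<close>.
  If \<open>u - u'\<close> is null there is a detour: through \<open>- u'\<close> if \<open>u\<close> is not null, otherwise through a
  null vector \<open>w\<close> that pairs with both \<open>u\<close> and \<open>u'\<close>. The vectors \<open>r\<close> and \<open>r'\<close> provide \<open>w\<close>. They
  say that \<open>u\<close> and \<open>u'\<close> are not in the radical of the orthogonal complement of \<open>K\<close>, which may be
  degenerate; otherwise \<open>u\<close> could be a null vector in \<open>K\<close>, which cannot be moved.
\<close>

lemma isometry_transitive_fixing:
  assumes norm: "B u u = B u' u'"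
    and u: "\<And>k. k \<in> K \<Longrightarrow> B k u = 0" and u': "\<And>k. k \<in> K \<Longrightarrow> B k u' = 0"
    and r: "\<And>k. k \<in> K \<Longrightarrow> B k r = 0" "B u r \<noteq> 0"
    and r': "\<And>k. k \<in> K \<Longrightarrow> B k r' = 0" "B u' r' \<noteq> 0"
  shows "\<exists>g. isometry g \<and> (\<forall>k\<in>K. g k = k) \<and> g u = u'"
proof -
  have move: "\<exists>g. isometry g \<and> (\<forall>k\<in>K. g k = k) \<and> g p = q"
    if "B p p = B q q" "B (p - q) (p - q) \<noteq> 0" "\<And>k. k \<in> K \<Longrightarrow> B k p = 0"
      "\<And>k. k \<in> K \<Longrightarrow> B k q = 0" for p q
  proof (intro exI conjI ballI)
    show "isometry (reflection (p - q))" using that(2) by (rule isometry_reflection)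
    show "reflection (p - q) k = k" if "k \<in> K" for k
      using \<open>\<And>k. k \<in> K \<Longrightarrow> B k p = 0\<close>[OF that] \<open>\<And>k. k \<in> K \<Longrightarrow> B k q = 0\<close>[OF that]
      by (intro reflection_fixes) (simp add: sym[of _ k] B_simps)
    show "reflection (p - q) p = q" using that(1,2) by (rule reflection_diff)
  qed
  have via: "\<exists>g. isometry g \<and> (\<forall>k\<in>K. g k = k) \<and> g p = q"
    if "\<exists>g. isometry g \<and> (\<forall>k\<in>K. g k = k) \<and> g p = m"
      "\<exists>g. isometry g \<and> (\<forall>k\<in>K. g k = k) \<and> g m = q" for p m q
  proof -
    from that obtain g h where "isometry g" "\<forall>k\<in>K. g k = k" "g p = m"
      "isometry h" "\<forall>k\<in>K. h k = k" "h m = q" by blast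
    then show ?thesis
      by (intro exI[of _ "h \<circ> g"]) (simp add: isometry_compose)
  qed
  show ?thesis
  proof (cases "B (u - u') (u - u') = 0")
    case False
    then show ?thesis using norm u u' by (intro move) auto
  next
    case diff_null: True
    show ?thesis
    proof (cases "B u u = 0")
      case False
      \<comment> \<open>By the parallelogram law \<open>u + u'\<close> is then not null.\<close>
      have "B (u + u') (u + u') \<noteq> 0" "B (- u' - u') (- u' - u') \<noteq> 0"
        using False diff_null norm by (simp_all add: B_simps)
      then show ?thesis
        using norm u u' by (intro via[of u "- u'" u'] move) (auto simp: B_simps)
    next
      case True
      have uu': "B u u' = 0" "B u' u = 0" "B u' u' = 0"
        using diff_null norm True sym[of u u'] by (simp_all add: B_simps)
      obtain s where s: "\<And>k. k \<in> K \<Longrightarrow> B k s = 0" "B u s \<noteq> 0" "B u' s \<noteq> 0"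
      proof (cases "B u' r = 0 \<and> B u r' = 0")
        case True
        then show ?thesis using that[of "r + r'"] r r' by (simp add: B_simps)
      next
        case False
        then show ?thesis using that[of r] that[of r'] r r' by blast
      qed
      \<comment> \<open>The multiple of \<open>u\<close> is chosen to make \<open>w\<close> null.\<close>
      define w where "w = s - (B s s / (2 * B u s)) *\<^sub>R u"
      have w: "B w w = 0" "B u w \<noteq> 0" "B u' w \<noteq> 0" "\<And>k. k \<in> K \<Longrightarrow> B k w = 0"
        using s u True uu' by (auto simp: w_def B_simps sym[of s u] field_simps)
      have "B (u - w) (u - w) \<noteq> 0" "B (w - u') (w - u') \<noteq> 0"
        using w True uu' by (simp_all add: B_simps sym[of w u] sym[of w u'])
      then show ?thesis
        using u u' w True uu' by (intro via[of u w u'] move) auto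
    qed
  qed
qed

end

locale nondegenerate_form = sym_bilinear_form +
  assumes nondegenerate: "(\<And>y. B x y = 0) \<Longrightarrow> x = 0"
begin

definition indep2 :: "'a \<Rightarrow> 'a \<Rightarrow> bool" where
  "indep2 p q \<longleftrightarrow> (\<forall>a b. a *\<^sub>R p + b *\<^sub>R q = 0 \<longrightarrow> a = 0 \<and> b = 0)"

lemma indep2_nonzero:
  assumes "indep2 p q"
  shows "p \<noteq> 0" "q \<noteq> 0"
  using assms[unfolded indep2_def, rule_format, of 1 0]
    assms[unfolded indep2_def, rule_format, of 0 1] by auto

lemma indep2_unimodular:
  assumes "indep2 p q" "a * d - b * c = 1"
  shows "indep2 (a *\<^sub>R p + b *\<^sub>R q) (c *\<^sub>R p + d *\<^sub>R q)"
  unfolding indep2_def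
proof (intro allI impI)
  fix s t assume "s *\<^sub>R (a *\<^sub>R p + b *\<^sub>R q) + t *\<^sub>R (c *\<^sub>R p + d *\<^sub>R q) = 0"
  then have "(s * a + t * c) *\<^sub>R p + (s * b + t * d) *\<^sub>R q = 0"
    by (simp add: algebra_simps)
  then have "s * a + t * c = 0" "s * b + t * d = 0"
    using assms(1) by (auto simp: indep2_def)
  then have "s * (a * d - b * c) = 0" "t * (a * d - b * c) = 0" by algebra+
  then show "s = 0 \<and> t = 0" using assms(2) by simp
qed

lemma ex_pairing:
  assumes "x \<noteq> 0"
  obtains y where "B x y \<noteq> 0"
  using nondegenerate assms by blast

text \<open>
  A vector orthogonal to everything that is orthogonal to \<open>p\<close> is a multiple of \<open>p\<close>. This is what
  makes the transitivity lemma applicable with \<open>K = {p}\<close>, even if \<open>p\<close> is null.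
\<close>

lemma ex_pairing_orthogonal:
  assumes "indep2 p q"
  obtains r where "B p r = 0" "B q r \<noteq> 0"
proof -
  obtain s where s: "B p s \<noteq> 0"
    using ex_pairing indep2_nonzero(1)[OF assms] by blast
  have "(- B q s) *\<^sub>R p + B p s *\<^sub>R q \<noteq> 0"
    using assms[unfolded indep2_def, rule_format, of "- B q s" "B p s"] s by blast
  then obtain t where t: "B ((- B q s) *\<^sub>R p + B p s *\<^sub>R q) t \<noteq> 0"
    using ex_pairing by blast
  \<comment> \<open>Subtracting from \<open>t\<close> a multiple of \<open>s\<close> makes it orthogonal to \<open>p\<close>.\<close>
  show thesis
  proof (rule that[of "t - (B p t / B p s) *\<^sub>R s"])
    show "B p (t - (B p t / B p s) *\<^sub>R s) = 0" "B q (t - (B p t / B p s) *\<^sub>R s) \<noteq> 0"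
      using s t by (simp_all add: B_simps field_simps)
  qed
qed

lemma isometry_transitive:
  assumes "u \<noteq> 0" "u' \<noteq> 0" "B u u = B u' u'"
  shows "\<exists>g. isometry g \<and> g u = u'"
proof -
  obtain r r' where "B u r \<noteq> 0" "B u' r' \<noteq> 0"
    using ex_pairing assms(1,2) by metis
  then show ?thesis
    using isometry_transitive_fixing[of u u' "{}" r r'] assms(3) by auto
qed

lemma isometry_indep2:
  assumes "isometry g" "indep2 p q"
  shows "indep2 (g p) (g q)"
  unfolding indep2_def
proof (intro allI impI)
  fix a b assume 0: "a *\<^sub>R g p + b *\<^sub>R g q = 0"
  have lin: "linear g" and iso: "\<And>x y. B (g x) (g y) = B x y"
    using assms(1) by (auto simp: isometry_def)
  have "g (a *\<^sub>R p + b *\<^sub>R q) = 0"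
    using 0 by (simp add: linear_add[OF lin] linear_scale[OF lin])
  then have "B (a *\<^sub>R p + b *\<^sub>R q) y = 0" for y
    using iso[of "a *\<^sub>R p + b *\<^sub>R q" y] by (simp add: B_simps)
  then have "a *\<^sub>R p + b *\<^sub>R q = 0" by (rule nondegenerate)
  then show "a = 0 \<and> b = 0"
    using assms(2) unfolding indep2_def by blast
qed

text \<open>Move \<open>p\<close> to \<open>p'\<close> first, and then the image of \<open>q\<close> to \<open>q'\<close> while fixing \<open>p'\<close>.\<close>

lemma isometry_transitive_orthogonal_pairs:
  assumes "indep2 p q" "B p q = 0" "indep2 p' q'" "B p' q' = 0"
    and "B p p = B p' p'" "B q q = B q' q'"
  shows "\<exists>g. isometry g \<and> g p = p' \<and> g q = q'"
proof -
  obtain g where g: "isometry g" "g p = p'"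
    using isometry_transitive indep2_nonzero assms by metis
  have pres: "B (g x) (g y) = B x y" for x y
    using g(1) by (simp add: isometry_def)
  have "indep2 p' (g q)"
    using isometry_indep2[OF g(1) assms(1)] g(2) by simp
  then obtain r where r: "B p' r = 0" "B (g q) r \<noteq> 0"
    by (rule ex_pairing_orthogonal)
  obtain r' where r': "B p' r' = 0" "B q' r' \<noteq> 0"
    using assms(3) by (rule ex_pairing_orthogonal)
  have "B p' (g q) = 0" "B (g q) (g q) = B q' q'"
    using pres[of p q] pres[of q q] g(2) assms by simp_all
  then obtain h where h: "isometry h" "h p' = p'" "h (g q) = q'"
    using isometry_transitive_fixing[of "g q" q' "{p'}" r r'] r r' assms(4) by auto
  show ?thesis
    using g h by (intro exI[of _ "h \<circ> g"]) (simp add: isometry_compose)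
qed

end


section \<open>The Freudenthal triple system as pairs of vectors of signature (2, n)\<close>

type_synonym 'm ambient = "(real \<times> (real ^ 'm)) \<times> real \<times> real"

fun ambient_form :: "'m::finite ambient \<Rightarrow> 'm ambient \<Rightarrow> real" where
  "ambient_form (A, s, t) (A', s', t') = mink A A' - (s * t' + t * s') / 2"

fun first_vec :: "'m::finite fts \<Rightarrow> 'm ambient" where
  "first_vec (\<alpha>, (a, A), (b, B), \<beta>) = (A, \<beta>, b)"

text \<open>
  The sign on the spatial part of the second vector turns the Euclidean pairing of \<open>A\<close> and \<open>B\<close> in
  the trace form into the Lorentzian one.
\<close>

fun second_vec :: "'m::finite fts \<Rightarrow> 'm ambient" where
  "second_vec (\<alpha>, (a, A), (b, b0, v), \<beta>) = ((b0, - v), a, \<alpha>)"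

fun of_vecs :: "'m::finite ambient \<Rightarrow> 'm ambient \<Rightarrow> 'm fts" where
  "of_vecs (A, \<beta>, b) ((b0, v), a, \<alpha>) = (\<alpha>, (a, A), (b, b0, - v), \<beta>)"

lemma first_second_of_vecs [simp]:
  "first_vec (of_vecs p q) = p" "second_vec (of_vecs p q) = q"
  by (induction p q rule: of_vecs.induct) simp_all

lemma of_vecs_first_second [simp]: "of_vecs (first_vec x) (second_vec x) = x"
  by (cases x) auto

interpretation ambient: nondegenerate_form ambient_form
proof
  show "bilinear ambient_form"
    by (auto simp: bilinear_def inner_simps field_simps intro!: linearI)
  show "ambient_form x y = ambient_form y x" for x y :: "'a ambient"
    by (induction x y rule: ambient_form.induct) (simp add: mink_commute algebra_simps)
  show "x = 0" if "\<And>y. ambient_form x y = 0" for x :: "'a ambient"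
  proof -
    obtain a v s t where x: "x = ((a, v), s, t)" by (metis prod.exhaust)
    \<comment> \<open>Each test vector isolates one component of \<open>x\<close>.\<close>
    have "a = 0" "v = 0" "s = 0" "t = 0"
      using that[of "((1, 0), 0, 0)"] that[of "((0, v), 0, 0)"]
        that[of "((0, 0), 0, 1)"] that[of "((0, 0), 1, 0)"] by (simp_all add: x)
    then show ?thesis by (simp add: x zero_prod_def)
  qed
qed

lemma linear_first_vec: "linear first_vec" and linear_second_vec: "linear second_vec"
  by (auto intro!: linearI)

lemma of_vecs_add: "of_vecs (p + p') (q + q') = of_vecs p q + of_vecs p' q'"
  by (cases p; cases p'; cases q; cases q') auto

lemma of_vecs_scale: "of_vecs (c *\<^sub>R p) (c *\<^sub>R q) = c *\<^sub>R of_vecs p q"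
  by (cases p; cases q) auto

lemma of_vecs_zero: "of_vecs 0 0 = 0"
  using of_vecs_scale[of 0 0 0] by simp

text \<open>
  The two invariants in terms of scalar products: the symplectic form is the tensor product of
  the scalar product with the area form of the plane, and the quartic form is the Gram
  determinant.
\<close>

lemma fts_form_vecs:
  "fts_form x y = 2 * (ambient_form (first_vec x) (second_vec y)
     - ambient_form (second_vec x) (first_vec y))"
  by (cases x; cases y) (auto simp: inner_commute field_simps)

lemma quartic_vecs:
  "quartic x = 4 * (ambient_form (first_vec x) (first_vec x) * ambient_form (second_vec x) (second_vec x)
     - (ambient_form (first_vec x) (second_vec x))\<^sup>2)"
  by (cases x) (auto simp: inner_commute power2_eq_square field_simps)


section \<open>Automorphisms\<close>

text \<open>Bijectivity comes for free: the symplectic form is nondegenerate and the dimension finite.\<close>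

lemma AutI:
  fixes \<sigma> :: "'m::finite fts \<Rightarrow> 'm fts"
  assumes "linear \<sigma>" "\<And>x y. fts_form (\<sigma> x) (\<sigma> y) = fts_form x y"
    and "\<And>x. quartic (\<sigma> x) = quartic x"
  shows "\<sigma> \<in> Aut"
proof -
  have "inj \<sigma>"
  proof (rule injI)
    fix x y assume "\<sigma> x = \<sigma> y"
    then have "fts_form x z = fts_form y z" for z
      using assms(2)[of x z] assms(2)[of y z] by simp
    then show "x = y" by (rule fts_form_nondegenerate)
  qed
  then have "bij \<sigma>"
    using linear_injective_imp_surjective[OF assms(1)] by (simp add: bij_def)
  then show ?thesis using assms by (simp add: Aut_def)
qed

lemma AutD:
  assumes "\<sigma> \<in> Aut"
  shows "linear \<sigma>" "bij \<sigma>" "fts_form (\<sigma> x) (\<sigma> y) = fts_form x y" "quartic (\<sigma> x) = quartic x"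
  using assms unfolding Aut_def by blast+

lemma Aut_compose: "\<sigma> \<in> Aut \<Longrightarrow> \<tau> \<in> Aut \<Longrightarrow> \<tau> \<circ> \<sigma> \<in> Aut"
  by (simp add: Aut_def linear_compose bij_comp del: split_paired_All)

lemma related_trans:
  assumes "related x y" "related y z"
  shows "related x z"
proof -
  obtain \<sigma> \<tau> where "\<sigma> \<in> Aut" "y = \<sigma> x" "\<tau> \<in> Aut" "z = \<tau> y"
    using assms by (auto simp: related_def)
  then show ?thesis
    unfolding related_def by (intro bexI[of _ "\<tau> \<circ> \<sigma>"]) (simp_all add: Aut_compose)
qed

text \<open>The orthogonal factor of the automorphism group.\<close>

lemma related_isometry:
  assumes "ambient.isometry g"
  shows "related (of_vecs p q) (of_vecs (g p) (g q))"
proof -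
  define \<sigma> where "\<sigma> x = of_vecs (g (first_vec x)) (g (second_vec x))" for x
  have lin: "linear g" and iso: "\<And>x y. ambient_form (g x) (g y) = ambient_form x y"
    using assms by (auto simp: ambient.isometry_def)
  have "\<sigma> \<in> Aut"
  proof (rule AutI)
    show "linear \<sigma>"
      by (rule linearI)
        (simp_all add: \<sigma>_def linear_add[OF lin] linear_add[OF linear_first_vec]
          linear_add[OF linear_second_vec] linear_scale[OF lin] linear_scale[OF linear_first_vec]
          linear_scale[OF linear_second_vec] of_vecs_add of_vecs_scale)
  qed (simp_all add: \<sigma>_def fts_form_vecs quartic_vecs iso)
  then show ?thesis
    unfolding related_def by (rule bexI[rotated]) (simp add: \<sigma>_def)
qed

text \<open>
  The \<open>SL(2, \<real>)\<close> factor. A general coefficient matrix would scale the symplectic form by its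
  determinant and the quartic form by the square of its determinant.
\<close>

lemma related_unimodular:
  assumes "a * d - b * c = 1"
  shows "related (of_vecs p q) (of_vecs (a *\<^sub>R p + b *\<^sub>R q) (c *\<^sub>R p + d *\<^sub>R q))"
proof -
  define \<sigma> where "\<sigma> x = of_vecs (a *\<^sub>R first_vec x + b *\<^sub>R second_vec x)
    (c *\<^sub>R first_vec x + d *\<^sub>R second_vec x)" for x :: "'a fts"
  have "\<sigma> \<in> Aut"
  proof (rule AutI)
    show "linear \<sigma>"
    proof (rule linearI)
      show "\<sigma> (x + y) = \<sigma> x + \<sigma> y" for x y
        unfolding \<sigma>_def of_vecs_add[symmetric] linear_add[OF linear_first_vec]
          linear_add[OF linear_second_vec] by (simp add: algebra_simps)
      show "\<sigma> (r *\<^sub>R x) = r *\<^sub>R \<sigma> x" for r x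
        unfolding \<sigma>_def of_vecs_scale[symmetric] linear_scale[OF linear_first_vec]
          linear_scale[OF linear_second_vec] by (simp add: algebra_simps)
    qed
    show "fts_form (\<sigma> x) (\<sigma> y) = fts_form x y" for x y
    proof -
      have "fts_form (\<sigma> x) (\<sigma> y) = (a * d - b * c) * fts_form x y"
        unfolding fts_form_vecs
        by (simp add: \<sigma>_def ambient.B_simps algebra_simps)
      then show ?thesis using assms by simp
    qed
    show "quartic (\<sigma> x) = quartic x" for x
    proof -
      have "quartic (\<sigma> x) = (a * d - b * c)\<^sup>2 * quartic x"
        unfolding quartic_vecs
        by (simp add: \<sigma>_def ambient.B_simps ambient.sym[of "second_vec x" "first_vec x"]) algebra
      then show ?thesis using assms by simp
    qed
  qed
  then show ?thesis
    unfolding related_def by (rule bexI[rotated]) (simp add: \<sigma>_def)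
qed

lemma related_swap: "related (of_vecs p q) (of_vecs q (- p))"
  using related_unimodular[of 0 0 1 "- 1" p q] by simp

lemma related_orthogonal_pairs:
  assumes "ambient.indep2 p q" "ambient_form p q = 0" "ambient.indep2 p' q'" "ambient_form p' q' = 0"
    and "ambient_form p p = ambient_form p' p'" "ambient_form q q = ambient_form q' q'"
  shows "related (of_vecs p q) (of_vecs p' q')"
proof -
  obtain g where "ambient.isometry g" "g p = p'" "g q = q'"
    using ambient.isometry_transitive_orthogonal_pairs[OF assms] by blast
  then show ?thesis using related_isometry[of g p q] by simp
qed

lemma related_single:
  assumes "p \<noteq> 0" "p' \<noteq> 0" "ambient_form p p = ambient_form p' p'"
  shows "related (of_vecs 0 p) (of_vecs 0 p')"
proof -
  obtain g where "ambient.isometry g" "g p = p'"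
    using ambient.isometry_transitive[OF assms] by blast
  then show ?thesis using related_isometry[of g 0 p]
    by (simp add: ambient.isometry_def linear_0)
qed


section \<open>Rank\<close>

lemma fts_form_triple_prod: "fts_form (triple_prod x y w) z = 2 * quartic_lin x y w z"
  using triple_prod_iff by blast

lemma fts_form_zero_iff: "t = 0 \<longleftrightarrow> (\<forall>z. fts_form t z = 0)"
  using fts_form_nondegenerate[of t 0] by (auto simp: bilinear_lzero[OF bilinear_fts_form])

lemma fts_form_Upsilon:
  "fts_form (Upsilon x y) z = 6 * quartic_lin x x y z + fts_form x y * fts_form x z"
  by (simp add: Upsilon_def bilinear_ladd[OF bilinear_fts_form] bilinear_lmul[OF bilinear_fts_form]
      fts_form_triple_prod)

text \<open>
  The Gram determinant is a difference of products of the quadratic forms \<open>\<langle>p, p\<rangle>\<close>, \<open>\<langle>q, q\<rangle>\<close> and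
  \<open>\<langle>p, q\<rangle>\<close>, so the polarization of products applies.
\<close>

lemma quartic_lin_vecs:
  fixes p q r s r' s' :: "'m::finite ambient"
  shows "quartic_lin (of_vecs p q) (of_vecs p q) (of_vecs r s) (of_vecs r' s') =
    2 / 3 * (ambient_form p p * ambient_form s s' + ambient_form q q * ambient_form r r'
       + 2 * ambient_form p r * ambient_form q s' + 2 * ambient_form p r' * ambient_form q s
       - (ambient_form p s + ambient_form q r) * (ambient_form p s' + ambient_form q r')
       - ambient_form p q * (ambient_form r s' + ambient_form s r'))"
proof -
  define F where "F x y = ambient_form (first_vec x) (first_vec y)" for x y :: "'m fts"
  define S where "S x y = ambient_form (second_vec x) (second_vec y)" for x y :: "'m fts"
  define M where "M x y = (ambient_form (first_vec x) (second_vec y)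
    + ambient_form (second_vec x) (first_vec y)) / 2" for x y :: "'m fts"
  note lin = linear_add[OF linear_first_vec] linear_add[OF linear_second_vec]
    linear_scale[OF linear_first_vec] linear_scale[OF linear_second_vec]
  have bil: "bilinear F" "bilinear S" "bilinear M"
    unfolding bilinear_def
    by (intro conjI allI linearI; simp add: F_def S_def M_def lin ambient.B_simps field_simps)+
  have sym: "F x y = F y x" "S x y = S y x" "M x y = M y x" for x y
    unfolding F_def S_def M_def
    by (simp_all only: ambient.sym[of "first_vec y"] ambient.sym[of "second_vec y"] add.commute)
  have quartic: "quartic = (\<lambda>x. 4 * (F x x * S x x) - 4 * (M x x * M x x))"
    by (rule ext) (simp add: quartic_vecs F_def S_def M_def power2_eq_square
        ambient.sym[of "second_vec _" "first_vec _"])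
  have lin4: "quartic_lin x y w z = 4 * polar4 (\<lambda>x. F x x * S x x) x y w z
      - 4 * polar4 (\<lambda>x. M x x * M x x) x y w z" for x y w z
    unfolding quartic_lin_def by (subst quartic) (simp only: polar4_lincomb)
  show ?thesis
    unfolding lin4 polar4_prod[OF bil(1,2) sym(1,2)] polar4_prod[OF bil(3,3) sym(3,3)]
    by (simp add: F_def S_def M_def ambient.sym[of q p] field_simps)
qed

text \<open>
  As the symplectic form is nondegenerate, its values decide whether \<open>\<Upsilon>\<close> or \<open>T\<close> vanishes.
  Beyond the Gram matrix of \<open>p\<close> and \<open>q\<close>, the values of \<open>\<Upsilon>\<close> involve
  \<open>\<langle>p, r\<rangle> \<langle>q, s'\<rangle> - \<langle>p, s'\<rangle> \<langle>q, r\<rangle>\<close>, which detects whether \<open>p\<close> and \<open>q\<close> are independent.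
\<close>

lemma fts_form_Upsilon_vecs:
  "fts_form (Upsilon (of_vecs p q) (of_vecs r s)) (of_vecs r' s') =
    4 * (ambient_form p p * ambient_form s s' + ambient_form q q * ambient_form r r'
       - ambient_form p q * (ambient_form r s' + ambient_form s r')
       + 2 * (ambient_form p r * ambient_form q s' - ambient_form p s' * ambient_form q r)
       + 2 * (ambient_form p r' * ambient_form q s - ambient_form p s * ambient_form q r'))"
  unfolding fts_form_Upsilon quartic_lin_vecs
  unfolding fts_form_vecs by simp algebra

lemma fts_form_triple_prod_vecs:
  "fts_form (triple_prod (of_vecs p q) (of_vecs p q) (of_vecs p q)) (of_vecs r s) =
    4 * (ambient_form p p * ambient_form q s + ambient_form q q * ambient_form p r
       - ambient_form p q * (ambient_form p s + ambient_form q r))"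
  unfolding fts_form_triple_prod quartic_lin_vecs
  by (simp add: ambient.sym[of q p] field_simps)

lemma Upsilon_diag: "Upsilon x x = 3 *\<^sub>R triple_prod x x x"
  by (simp add: Upsilon_def fts_form_vecs ambient.sym[of "second_vec x"])

text \<open>
  The linearization, the triple product and \<open>\<Upsilon>\<close> are built from the two invariant forms and
  addition alone, so automorphisms commute with them.
\<close>

lemma Aut_quartic_lin:
  assumes "\<sigma> \<in> Aut"
  shows "quartic_lin (\<sigma> x) (\<sigma> y) (\<sigma> w) (\<sigma> z) = quartic_lin x y w z"
proof -
  have lin: "linear \<sigma>" and q: "\<And>x. quartic (\<sigma> x) = quartic x"
    using AutD[OF assms] by blast+
  show ?thesis
    unfolding quartic_lin_def polar4_def linear_add[OF lin, symmetric] q ..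
qed

lemma Aut_zero_iff: "\<sigma> \<in> Aut \<Longrightarrow> \<sigma> x = 0 \<longleftrightarrow> x = 0"
  using AutD(2)[of \<sigma>] linear_0[OF AutD(1)[of \<sigma>]] by (metis bij_pointE)

lemma Aut_triple_prod:
  assumes "\<sigma> \<in> Aut"
  shows "triple_prod (\<sigma> x) (\<sigma> y) (\<sigma> w) = \<sigma> (triple_prod x y w)"
proof (rule sym, unfold triple_prod_iff, rule allI)
  fix z
  obtain z' where z: "z = \<sigma> z'"
    using AutD(2)[OF assms] by (metis bij_pointE)
  show "fts_form (\<sigma> (triple_prod x y w)) z = 2 * quartic_lin (\<sigma> x) (\<sigma> y) (\<sigma> w) z"
    by (simp add: z Aut_quartic_lin[OF assms] AutD(3)[OF assms] fts_form_triple_prod)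
qed

lemma rank_related:
  assumes "related x y"
  shows "rank1 y = rank1 x" "rank2 y = rank2 x" "rank3 y = rank3 x" "rank4 y = rank4 x"
proof -
  obtain \<sigma> where \<sigma>: "\<sigma> \<in> Aut" and y: "y = \<sigma> x"
    using assms by (auto simp: related_def)
  have lin: "linear \<sigma>" and surj: "surj \<sigma>" and q: "quartic y = quartic x"
    and form: "\<And>u v. fts_form (\<sigma> u) (\<sigma> v) = fts_form u v"
    using AutD[OF \<sigma>] bij_is_surj unfolding y by blast+
  have U: "Upsilon y (\<sigma> z) = \<sigma> (Upsilon x z)" for z
    by (simp add: Upsilon_def y Aut_triple_prod[OF \<sigma>] form linear_add[OF lin] linear_scale[OF lin])
  have "(\<forall>z. Upsilon y z = 0) \<longleftrightarrow> (\<forall>z\<in>range \<sigma>. Upsilon y z = 0)"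
    unfolding surj by blast
  also have "\<dots> \<longleftrightarrow> (\<forall>z. Upsilon x z = 0)"
    unfolding ball_simps U Aut_zero_iff[OF \<sigma>] by blast
  finally have "(\<forall>z. Upsilon y z = 0) \<longleftrightarrow> (\<forall>z. Upsilon x z = 0)" .
  moreover have "y = 0 \<longleftrightarrow> x = 0" "triple_prod y y y = 0 \<longleftrightarrow> triple_prod x x x = 0"
    by (simp_all add: y Aut_triple_prod[OF \<sigma>] Aut_zero_iff[OF \<sigma>])
  ultimately show "rank1 y = rank1 x" "rank2 y = rank2 x" "rank3 y = rank3 x" "rank4 y = rank4 x"
    unfolding rank1_def rank2_def rank3_def rank4_def q by blast+
qed

lemma fts_all_vecs: "(\<forall>z. P z) \<longleftrightarrow> (\<forall>r s. P (of_vecs r s))"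
  by (metis of_vecs_first_second)

text \<open>
  On a pair \<open>(0, p)\<close> the triple product and the quartic form vanish, and \<open>\<Upsilon>\<close> sees only the square
  of \<open>p\<close>.
\<close>

lemma rank_single:
  fixes p :: "'m::finite ambient"
  assumes "p \<noteq> 0"
  shows "rank1 (of_vecs 0 p) \<Longrightarrow> ambient_form p p = 0"
    and "rank2 (of_vecs 0 p) \<Longrightarrow> ambient_form p p \<noteq> 0"
    and "\<not> rank3 (of_vecs 0 p)" and "\<not> rank4 (of_vecs 0 p)"
proof -
  let ?x = "of_vecs 0 p"
  have U: "fts_form (Upsilon ?x (of_vecs r s)) (of_vecs r' s')
      = 4 * (ambient_form p p * ambient_form r r')" for r s r' s'
    by (simp add: fts_form_Upsilon_vecs ambient.B_simps)
  have "triple_prod ?x ?x ?x = 0"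
    unfolding fts_form_zero_iff fts_all_vecs fts_form_triple_prod_vecs
    by (simp add: ambient.B_simps)
  moreover have "quartic ?x = 0"
    by (simp add: quartic_vecs ambient.B_simps)
  ultimately show "\<not> rank3 ?x" "\<not> rank4 ?x"
    by (simp_all add: rank3_def rank4_def)
  show "ambient_form p p = 0" if "rank1 ?x"
  proof -
    \<comment> \<open>Any non-null vector would do.\<close>
    let ?e = "((1, 0), 0, 0) :: 'm ambient"
    have "Upsilon ?x (of_vecs ?e 0) = 0" using that unfolding rank1_def by blast
    then show ?thesis
      using U[of ?e 0 ?e 0] by (simp add: bilinear_lzero[OF bilinear_fts_form])
  qed
  show "ambient_form p p \<noteq> 0" if "rank2 ?x"
  proof
    assume "ambient_form p p = 0"
    then have "\<forall>y. Upsilon ?x y = 0"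
      unfolding fts_form_zero_iff fts_all_vecs U by simp
    then show False using that unfolding rank2_def by blast
  qed
qed

text \<open>
  On an orthogonal pair the triple product is the pair \<open>(2 \<langle>p, p\<rangle> q, - 2 \<langle>q, q\<rangle> p)\<close>, so it vanishes exactly when both vectors are null. The vectors \<open>r\<close> and \<open>s\<close>
  in the proof witness that \<open>\<Upsilon>\<close> still does not vanish then, because \<open>p\<close> and \<open>q\<close> are independent.
\<close>

lemma rank_orthogonal_pair:
  assumes ind: "ambient.indep2 p q" and orth: "ambient_form p q = 0"
  shows "\<not> rank1 (of_vecs p q)"
    and "rank2 (of_vecs p q) \<Longrightarrow> ambient_form p p = 0 \<and> ambient_form q q = 0"
    and "rank3 (of_vecs p q) \<Longrightarrow> (ambient_form p p = 0) \<noteq> (ambient_form q q = 0)"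
    and "rank4 (of_vecs p q) \<Longrightarrow> ambient_form p p \<noteq> 0 \<and> ambient_form q q \<noteq> 0"
proof -
  let ?x = "of_vecs p q"
  obtain r s where r: "ambient_form p r \<noteq> 0" and s: "ambient_form q s \<noteq> 0" "ambient_form p s = 0"
    using ambient.ex_pairing ambient.indep2_nonzero[OF ind] ambient.ex_pairing_orthogonal[OF ind]
    by metis
  have T: "fts_form (triple_prod ?x ?x ?x) (of_vecs r' s')
      = 4 * (ambient_form p p * ambient_form q s' + ambient_form q q * ambient_form p r')" for r' s'
    by (simp add: fts_form_triple_prod_vecs orth)
  have T0: "triple_prod ?x ?x ?x = 0 \<longleftrightarrow> ambient_form p p = 0 \<and> ambient_form q q = 0"
  proof
    assume "triple_prod ?x ?x ?x = 0"
    then show "ambient_form p p = 0 \<and> ambient_form q q = 0"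
      using T[of 0 s] T[of r 0] r s
      by (simp add: bilinear_lzero[OF bilinear_fts_form] ambient.B_simps)
  next
    assume "ambient_form p p = 0 \<and> ambient_form q q = 0"
    then show "triple_prod ?x ?x ?x = 0"
      unfolding fts_form_zero_iff fts_all_vecs T by simp
  qed
  show "\<not> rank1 ?x"
  proof
    assume "rank1 ?x"
    then have U0: "Upsilon ?x y = 0" for y unfolding rank1_def by blast
    then have "triple_prod ?x ?x ?x = 0"
      using Upsilon_diag[of ?x] by simp
    then have "fts_form (Upsilon ?x (of_vecs r 0)) (of_vecs 0 s)
        = 8 * (ambient_form p r * ambient_form q s)"
      using T0 by (simp add: fts_form_Upsilon_vecs orth s ambient.B_simps)
    then show False
      using r s U0 by (simp add: bilinear_lzero[OF bilinear_fts_form])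
  qed
  show "rank2 ?x \<Longrightarrow> ambient_form p p = 0 \<and> ambient_form q q = 0"
    using T0 by (simp add: rank2_def)
  show "rank3 ?x \<Longrightarrow> (ambient_form p p = 0) \<noteq> (ambient_form q q = 0)"
    using T0 by (auto simp: rank3_def quartic_vecs orth)
  show "rank4 ?x \<Longrightarrow> ambient_form p p \<noteq> 0 \<and> ambient_form q q \<noteq> 0"
    by (auto simp: rank4_def quartic_vecs orth)
qed


section \<open>Reduction to normal form\<close>

lemma related_single_if_dependent:
  assumes "\<not> ambient.indep2 p q" "of_vecs p q \<noteq> 0"
  shows "\<exists>r. r \<noteq> 0 \<and> related (of_vecs p q) (of_vecs 0 r)"
proof (cases "q = 0")
  case True
  then have "p \<noteq> 0" "related (of_vecs p q) (of_vecs 0 p)"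
    using related_unimodular[of 0 0 "-1" 1 p q] assms(2) by (auto simp: of_vecs_zero)
  then show ?thesis by blast
next
  case False
  obtain a b where ab: "a *\<^sub>R p + b *\<^sub>R q = 0" "a \<noteq> 0 \<or> b \<noteq> 0"
    using assms(1) by (auto simp: ambient.indep2_def)
  then have "a \<noteq> 0" using False by auto
  have "p + (b / a) *\<^sub>R q = (1 / a) *\<^sub>R (a *\<^sub>R p + b *\<^sub>R q)"
    using \<open>a \<noteq> 0\<close> by (simp add: algebra_simps)
  then have "p + (b / a) *\<^sub>R q = 0" using ab by simp
  then have "related (of_vecs p q) (of_vecs 0 q)"
    using related_unimodular[of 1 1 "b / a" 0 p q] by simp
  then show ?thesis using False by blast
qed

text \<open>
  A Gram-Schmidt step is unimodular, but needs a non-null vector in the plane spanned by \<open>p\<close> and \<open>q\<close>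
  to start from. If \<open>p\<close> and \<open>q\<close> are null and not orthogonal, then \<open>p + q\<close> is one.
\<close>

lemma related_orthogonal_if_indep:
  assumes "ambient.indep2 p q"
  shows "\<exists>p' q'. ambient.indep2 p' q' \<and> ambient_form p' q' = 0 \<and> related (of_vecs p q) (of_vecs p' q')"
proof -
  have non_null: ?thesis
    if "a * d - b * c = 1" "ambient_form (a *\<^sub>R p + b *\<^sub>R q) (a *\<^sub>R p + b *\<^sub>R q) \<noteq> 0" for a b c d
  proof -
    define p' where "p' = a *\<^sub>R p + b *\<^sub>R q"
    define q' where "q' = c *\<^sub>R p + d *\<^sub>R q"
    define k where "k = ambient_form p' q' / ambient_form p' p'"
    have "ambient.indep2 p' q'" "related (of_vecs p q) (of_vecs p' q')"
      using ambient.indep2_unimodular[OF assms that(1)] related_unimodular[OF that(1)]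
      by (simp_all add: p'_def q'_def)
    moreover have "ambient_form p' (q' - k *\<^sub>R p') = 0"
      using that(2) by (simp add: p'_def[symmetric] k_def ambient.B_simps)
    moreover have "related (of_vecs p' q') (of_vecs p' (q' - k *\<^sub>R p'))"
      using related_unimodular[of 1 1 0 "- k" p' q'] by simp
    ultimately show ?thesis
      using ambient.indep2_unimodular[of p' q' 1 1 0 "- k"] related_trans
      by (intro exI[of _ p'] exI[of _ "q' - k *\<^sub>R p'"]) simp_all
  qed
  consider "ambient_form p p \<noteq> 0" | "ambient_form q q \<noteq> 0"
    | "ambient_form p p = 0" "ambient_form q q = 0" "ambient_form p q \<noteq> 0"
    | "ambient_form p q = 0" by blast
  then show ?thesis
  proof cases
    case 1
    then show ?thesis using non_null[of 1 1 0 0] by simp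
  next
    case 2
    then show ?thesis using non_null[of 0 0 1 "-1"] by simp
  next
    case 3
    then show ?thesis
      using non_null[of 1 1 1 0] ambient.sym[of q p] by (simp add: ambient.B_simps)
  next
    case 4
    moreover have "related (of_vecs p q) (of_vecs p q)"
      using related_unimodular[of 1 1 0 0 p q] by simp
    ultimately show ?thesis using assms by blast
  qed
qed

lemma related_single_unit:
  assumes "p \<noteq> 0" "ambient_form p p \<noteq> 0" "ambient_form r r = sgn (ambient_form p p)"
  shows "related (of_vecs 0 p) (of_vecs 0 r)"
proof -
  define t where "t = 1 / sqrt \<bar>ambient_form p p\<bar>"
  have t: "t \<noteq> 0" "t * t * ambient_form p p = sgn (ambient_form p p)"
    using assms(2) by (auto simp: t_def sgn_real_def real_sqrt_mult_self abs_if field_simps)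
  have "r \<noteq> 0" using assms(2,3) by (auto simp: ambient.B_simps sgn_zero_iff)
  then have "related (of_vecs 0 (t *\<^sub>R p)) (of_vecs 0 r)"
    using t assms by (intro related_single) (simp_all add: ambient.B_simps mult.assoc)
  moreover have "related (of_vecs 0 p) (of_vecs 0 (t *\<^sub>R p))"
    using related_unimodular[of "1 / t" t 0 0 0 p] t(1) by simp
  ultimately show ?thesis by (rule related_trans[rotated])
qed

text \<open>Scaling \<open>p\<close> by \<open>t\<close> and \<open>q\<close> by \<open>1 / t\<close> is unimodular.\<close>

lemma related_orthogonal_scaled:
  assumes "ambient.indep2 p q" "ambient_form p q = 0" "t \<noteq> 0"
    and "ambient.indep2 p' q'" "ambient_form p' q' = 0"
    and "ambient_form p' p' = t\<^sup>2 * ambient_form p p" "ambient_form q' q' = ambient_form q q / t\<^sup>2"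
  shows "related (of_vecs p q) (of_vecs p' q')"
proof -
  have "ambient.indep2 (t *\<^sub>R p) ((1 / t) *\<^sub>R q)"
    using ambient.indep2_unimodular[OF assms(1), of t "1 / t" 0 0] assms(3) by simp
  then have "related (of_vecs (t *\<^sub>R p) ((1 / t) *\<^sub>R q)) (of_vecs p' q')"
    using assms by (intro related_orthogonal_pairs)
      (simp_all add: ambient.B_simps power2_eq_square field_simps)
  moreover have "related (of_vecs p q) (of_vecs (t *\<^sub>R p) ((1 / t) *\<^sub>R q))"
    using related_unimodular[of t "1 / t" 0 0 p q] assms(3) by simp
  ultimately show ?thesis by (rule related_trans[rotated])
qed

lemma related_pair_rank3:
  assumes "ambient.indep2 p q" "ambient_form p q = 0" "ambient_form p p \<noteq> 0" "ambient_form q q = 0"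
    and "ambient.indep2 p' q'" "ambient_form p' q' = 0"
    and "ambient_form p' p' = sgn (ambient_form p p)" "ambient_form q' q' = 0"
  shows "related (of_vecs p q) (of_vecs p' q')"
proof -
  define t where "t = 1 / sqrt \<bar>ambient_form p p\<bar>"
  have t: "t \<noteq> 0" "t\<^sup>2 * ambient_form p p = sgn (ambient_form p p)"
    using assms(3) by (auto simp: t_def sgn_real_def power_divide abs_if field_simps)
  show ?thesis
    by (rule related_orthogonal_scaled[of p q t]) (use t assms in simp_all)
qed

text \<open>
  With \<open>P = \<bar>\<langle>p, p\<rangle>\<bar>\<close> and \<open>Q = \<bar>\<langle>q, q\<rangle>\<bar>\<close>, the invariant product \<open>P Q\<close> must become \<open>k\<^sup>4\<close>, the product
  of the absolute squares of \<open>k p'\<close> and \<open>k q'\<close>. The scaling \<open>t\<close> balances the two squares, that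
  is, it solves \<open>t\<^sup>2 P = Q / t\<^sup>2\<close>.
\<close>

lemma related_pair_rank4:
  fixes p q :: "'m::finite ambient"
  assumes "ambient.indep2 p q" "ambient_form p q = 0" "ambient_form p p \<noteq> 0" "ambient_form q q \<noteq> 0"
  shows "\<exists>k>0. \<forall>p' q'. ambient.indep2 p' q' \<longrightarrow> ambient_form p' q' = 0 \<longrightarrow>
    ambient_form p' p' = sgn (ambient_form p p) \<longrightarrow> ambient_form q' q' = sgn (ambient_form q q) \<longrightarrow>
    related (of_vecs p q) (k *\<^sub>R of_vecs p' q')"
proof -
  define P where "P = \<bar>ambient_form p p\<bar>"
  define Q where "Q = \<bar>ambient_form q q\<bar>"
  define t where "t = sqrt (sqrt (Q / P))"
  define k where "k = sqrt (sqrt (P * Q))"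
  have pos: "P > 0" "Q > 0" using assms by (simp_all add: P_def Q_def)
  have "t > 0" "k > 0" using pos by (simp_all add: t_def k_def)
  have t2: "t\<^sup>2 = sqrt Q / sqrt P" and k2: "k\<^sup>2 = sqrt P * sqrt Q"
    using pos unfolding t_def k_def real_sqrt_divide[symmetric] real_sqrt_mult[symmetric]
    by (simp_all add: less_imp_le)
  have k2': "k\<^sup>2 = t\<^sup>2 * P" "k\<^sup>2 = Q / t\<^sup>2"
    using pos real_sqrt_mult_self[of P] real_sqrt_mult_self[of Q]
    by (simp_all add: t2 k2 field_simps)
  have sgnP: "ambient_form p p = sgn (ambient_form p p) * P"
    "ambient_form q q = sgn (ambient_form q q) * Q"
    by (simp_all add: P_def Q_def sgn_mult_abs)
  show ?thesis
  proof (intro exI[of _ k] conjI allI impI)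
    show "k > 0" by fact
    fix p' q' :: "'m ambient"
    assume *: "ambient.indep2 p' q'" "ambient_form p' q' = 0"
      "ambient_form p' p' = sgn (ambient_form p p)" "ambient_form q' q' = sgn (ambient_form q q)"
    have "ambient.indep2 (k *\<^sub>R p') (k *\<^sub>R q')"
      unfolding ambient.indep2_def
    proof (intro allI impI)
      fix a b assume "a *\<^sub>R k *\<^sub>R p' + b *\<^sub>R k *\<^sub>R q' = 0"
      then have "a * k = 0 \<and> b * k = 0"
        using *(1)[unfolded ambient.indep2_def, rule_format, of "a * k" "b * k"] by simp
      then show "a = 0 \<and> b = 0" using \<open>k > 0\<close> by simp
    qed
    moreover have "ambient_form (k *\<^sub>R p') (k *\<^sub>R p') = t\<^sup>2 * ambient_form p p"
      by (subst sgnP(1)) (simp add: * ambient.B_simps k2'(1)[unfolded power2_eq_square]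
          mult.assoc[symmetric] power2_eq_square)
    moreover have "ambient_form (k *\<^sub>R q') (k *\<^sub>R q') = ambient_form q q / t\<^sup>2"
      by (subst sgnP(2)) (simp add: * ambient.B_simps k2'(2)[unfolded power2_eq_square]
          mult.assoc[symmetric] power2_eq_square)
    ultimately show "related (of_vecs p q) (k *\<^sub>R of_vecs p' q')"
      unfolding of_vecs_scale[symmetric] using assms * \<open>t > 0\<close>
      by (intro related_orthogonal_scaled[of p q t]) (simp_all add: ambient.B_simps)
  qed
qed


section \<open>The canonical forms\<close>

text \<open>The two vectors of the triple \<open>(1, (a; a\<^sub>0, a\<^sub>1), 0, 0)\<close>, of which all canonical forms are multiples.\<close>

definition canonical_first :: "'m::finite \<Rightarrow> real \<Rightarrow> real \<Rightarrow> 'm ambient" where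
  "canonical_first i1 a0 a1 = ((a0, axis i1 a1), 0, 0)"

definition canonical_second :: "real \<Rightarrow> 'm::finite ambient" where
  "canonical_second a = (0, a, 1)"

lemma canonical_vecs:
  "(1, jelem i1 a a0 a1, 0, 0) = of_vecs (canonical_first i1 a0 a1) (canonical_second a)"
  "canonical_first i1 0 0 = 0"
  by (simp_all add: canonical_first_def canonical_second_def jelem_def zero_prod_def axis_def
      vec_eq_iff)

lemma canonical_form:
  "ambient_form (canonical_first i1 a0 a1) (canonical_first i1 a0 a1) = a0\<^sup>2 - a1\<^sup>2"
  "ambient_form (canonical_second a :: 'm::finite ambient) (canonical_second a) = - a"
  "ambient_form (canonical_first i1 a0 a1) (canonical_second a) = 0"
  by (simp_all add: canonical_first_def canonical_second_def zero_prod_def inner_axis_axis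
      power2_eq_square)

lemma canonical_second_nonzero: "canonical_second a \<noteq> 0"
  by (simp add: canonical_second_def zero_prod_def)

lemma canonical_indep:
  assumes "a0 \<noteq> 0 \<or> a1 \<noteq> 0"
  shows "ambient.indep2 (canonical_first i1 a0 a1) (canonical_second a)"
  using assms by (auto simp: ambient.indep2_def canonical_first_def canonical_second_def
      zero_prod_def axis_def vec_eq_iff)

theorem theorem2:
  fixes x :: "'m::finite fts" and i1 :: 'm
  shows
    "(rank1 x \<longrightarrow>
        related x (1, jelem i1 0 0 0, 0, 0)) \<and>
     (rank2 x \<longrightarrow>
        related x (1, jelem i1 1 0 0, 0, 0) \<or>
        related x (1, jelem i1 (-1) 0 0, 0, 0) \<or>
        related x (1, jelem i1 0 (1/2) (1/2), 0, 0)) \<and>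
     (rank3 x \<longrightarrow>
        related x (1, jelem i1 0 1 0, 0, 0) \<or>
        related x (1, jelem i1 0 0 1, 0, 0)) \<and>
     (rank4 x \<longrightarrow>
        (\<exists>k>0. related x (k *\<^sub>R (1, jelem i1 (-1) 1 0, 0, 0)) \<or>
               related x (k *\<^sub>R (1, jelem i1 1 0 1, 0, 0)) \<or>
               related x (k *\<^sub>R (1, jelem i1 (-1) 0 1, 0, 0))))"
proof (cases "x = 0")
  case True
  then show ?thesis by (simp add: rank1_def rank2_def rank3_def rank4_def)
next
  case False
  show ?thesis
  proof (cases "ambient.indep2 (first_vec x) (second_vec x)")
    case False
    then obtain r where r: "r \<noteq> 0" "related x (of_vecs 0 r)"
      using related_single_if_dependent[of "first_vec x" "second_vec x"] \<open>x \<noteq> 0\<close>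
      unfolding of_vecs_first_second by blast
    note rank = rank_single[OF r(1), unfolded rank_related[OF r(2)]]
    have "related x (of_vecs 0 (canonical_second 0))" if "rank1 x"
      using rank(1)[OF that] r(1)
      by (intro related_trans[OF r(2)] related_single)
        (simp_all add: canonical_form canonical_second_nonzero)
    moreover have "related x (of_vecs 0 (canonical_second 1)) \<or>
        related x (of_vecs 0 (canonical_second (-1)))" if "rank2 x"
    proof (cases "ambient_form r r > 0")
      case True
      then have "related (of_vecs 0 r) (of_vecs 0 (canonical_second (-1)))"
        using r(1) by (intro related_single_unit) (simp_all add: canonical_form)
      then show ?thesis using related_trans[OF r(2)] by blast
    next
      case False
      then have "related (of_vecs 0 r) (of_vecs 0 (canonical_second 1))"
        using r(1) rank(2)[OF that] by (intro related_single_unit) (simp_all add: canonical_form)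
      then show ?thesis using related_trans[OF r(2)] by blast
    qed
    ultimately show ?thesis
      using rank(3,4) unfolding canonical_vecs by blast
  next
    case True
    then obtain p q where pq: "ambient.indep2 p q" "ambient_form p q = 0" "related x (of_vecs p q)"
      using related_orthogonal_if_indep[OF True] unfolding of_vecs_first_second by blast
    \<comment> \<open>The quarter turn exchanges the two squares, which lets one choose which of them comes first.\<close>
    have swap: "ambient.indep2 q (- p)" "ambient_form q (- p) = 0" "related x (of_vecs q (- p))"
      using ambient.indep2_unimodular[OF pq(1), of 0 0 1 "-1"] pq(2) ambient.sym[of q p]
        related_trans[OF pq(3) related_swap] by (simp_all add: ambient.B_simps)
    note rank = rank_orthogonal_pair[OF pq(1,2), unfolded rank_related[OF pq(3)]]
    have "related x (of_vecs (canonical_first i1 (1/2) (1/2)) (canonical_second 0))" if "rank2 x"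
      using rank(2)[OF that] pq canonical_indep[of "1/2" "1/2" i1 0]
      by (intro related_trans[OF pq(3)] related_orthogonal_pairs)
        (simp_all add: canonical_form)
    moreover have "related x (of_vecs (canonical_first i1 1 0) (canonical_second 0)) \<or>
        related x (of_vecs (canonical_first i1 0 1) (canonical_second 0))" if "rank3 x"
    proof -
      have pair: ?thesis if "ambient.indep2 u v" "ambient_form u v = 0" "related x (of_vecs u v)"
        "ambient_form u u \<noteq> 0" "ambient_form v v = 0" for u v
      proof (cases "ambient_form u u > 0")
        case True
        then have "related (of_vecs u v) (of_vecs (canonical_first i1 1 0) (canonical_second 0))"
          using that by (intro related_pair_rank3) (simp_all add: canonical_form canonical_indep)
        then show ?thesis using related_trans[OF that(3)] by blast
      next
        case False
        then have "related (of_vecs u v) (of_vecs (canonical_first i1 0 1) (canonical_second 0))"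
          using that by (intro related_pair_rank3) (simp_all add: canonical_form canonical_indep)
        then show ?thesis using related_trans[OF that(3)] by blast
      qed
      show ?thesis
      proof (cases "ambient_form p p = 0")
        case True
        then show ?thesis using rank(3)[OF that] by (intro pair[OF swap]) (simp_all add: ambient.B_simps)
      next
        case False
        then show ?thesis using rank(3)[OF that] by (intro pair[OF pq]) simp_all
      qed
    qed
    moreover have "\<exists>k>0. related x (k *\<^sub>R of_vecs (canonical_first i1 1 0) (canonical_second (-1))) \<or>
        related x (k *\<^sub>R of_vecs (canonical_first i1 0 1) (canonical_second 1)) \<or>
        related x (k *\<^sub>R of_vecs (canonical_first i1 0 1) (canonical_second (-1)))" if "rank4 x"
    proof -
      \<comment> \<open>Only a positive first and a negative second square are excluded: such a pair is swapped.\<close>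
      have pair: ?thesis if "ambient.indep2 u v" "ambient_form u v = 0" "related x (of_vecs u v)"
        "ambient_form u u \<noteq> 0" "ambient_form v v \<noteq> 0" "ambient_form u u < 0 \<or> ambient_form v v > 0"
      for u v
      proof -
        note uv = that
        obtain k where k: "k > 0" "\<forall>p' q'. ambient.indep2 p' q' \<longrightarrow> ambient_form p' q' = 0 \<longrightarrow>
            ambient_form p' p' = sgn (ambient_form u u) \<longrightarrow>
            ambient_form q' q' = sgn (ambient_form v v) \<longrightarrow>
            related (of_vecs u v) (k *\<^sub>R of_vecs p' q')"
          using related_pair_rank4[OF uv(1,2,4,5)] by blast
        have rel: "related x (k *\<^sub>R of_vecs (canonical_first i1 a0 a1) (canonical_second a))"
          if "a0 \<noteq> 0 \<or> a1 \<noteq> 0" "a0\<^sup>2 - a1\<^sup>2 = sgn (ambient_form u u)" "- a = sgn (ambient_form v v)"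
          for a0 a1 a
          using that by (intro related_trans[OF uv(3)] k(2)[rule_format])
            (simp_all add: canonical_form canonical_indep)
        consider "ambient_form u u > 0" "ambient_form v v > 0"
          | "ambient_form u u < 0" "ambient_form v v > 0"
          | "ambient_form u u < 0" "ambient_form v v < 0"
          using uv(4,5,6) unfolding neq_iff by blast
        then show ?thesis
        proof cases
          case 1
          then have "related x (k *\<^sub>R of_vecs (canonical_first i1 1 0) (canonical_second (-1)))"
            by (intro rel) simp_all
          then show ?thesis using k(1) by blast
        next
          case 2
          then have "related x (k *\<^sub>R of_vecs (canonical_first i1 0 1) (canonical_second (-1)))"
            by (intro rel) simp_all
          then show ?thesis using k(1) by blast
        next
          case 3
          then have "related x (k *\<^sub>R of_vecs (canonical_first i1 0 1) (canonical_second 1))"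
            by (intro rel) simp_all
          then show ?thesis using k(1) by blast
        qed
      qed
      note nz = rank(4)[OF that]
      show ?thesis
      proof (cases "ambient_form p p < 0 \<or> ambient_form q q > 0")
        case True
        then show ?thesis using nz by (intro pair[OF pq]) simp_all
      next
        case False
        then show ?thesis using nz by (intro pair[OF swap]) (auto simp: ambient.B_simps)
      qed
    qed
    ultimately show ?thesis
      using rank(1) unfolding canonical_vecs(1) by blast
  qed
qed

end
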